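(* Consider the Online Interval Selection problem on inputs that are simple chains, in the random order model. The basic greedy algorithm without revoking has competitive ratio exactly $1-\frac{1}{e^2}$ on this class of inputs. That is, $1-e^{-2}$ is the largest real number $\rho$ for which there exists a constant $b$ such that, for every simple chain $I$ of $n\ge 1$ intervals, $\mathbb{E}_\sigma\left[\mathrm{ALG}(I,\sigma)\right]\ \ge\ \rho\cdot \mathrm{OPT}(I)-b$, where $\mathrm{ALG}(I,\sigma)$ is the number of intervals selected by the basic greedy algorithm when the intervals of $I$ arrive in the order $\sigma$, and $\sigma$ is a uniformly random permutation.
   Context: A simple chain of size $n$ is a set of $n$ unit-length intervals $I_1,\dots,I_n$ on the real line, numbered from left to right, such that $I_i$ and $I_j$ ($i\neq j$) overlap if and only if $|i-j|=1$ (the intersection graph is a path on $n$ vertices in this order). Online Interval Selection (unweighted): intervals arrive one by one, and the algorithm accepts or rejects each interval on arrival so that the selected intervals are pairwise non-overlapping. The value of the algorithm is the number of selected intervals. $\mathrm{OPT}(I)$ is the maximum size of a set of pairwise non-overlapping intervals of $I$ (equal to $\lceil n/2\rceil$ for a simple chain of size $n$). Random order model: the set of intervals is fixed by an adversary and then presented in a uniformly random order; the algorithm's performance is its expected value over this order. Basic greedy algorithm: accept an arriving interval if and only if it does not overlap any previously selected interval; never revoke. *)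

theory Defs
  imports "HOL-Probability.Random_Permutations"
begin

text \<open>
  Intervals are half-open, so two intervals that merely touch at an endpoint do not overlap.
\<close>

definition overlap :: "real set \<Rightarrow> real set \<Rightarrow> bool" where
  "overlap A B \<longleftrightarrow> A \<inter> B \<noteq> {}"

definition simple_chain :: "nat \<Rightarrow> real set set \<Rightarrow> bool" where
  "simple_chain n I \<longleftrightarrow>
     (\<exists>a :: nat \<Rightarrow> real.
        strict_mono_on {1..n} a \<and>
        I = (\<lambda>i. {a i..<a i + 1}) ` {1..n} \<and>
        (\<forall>i\<in>{1..n}. \<forall>j\<in>{1..n}. i \<noteq> j \<longrightarrow>
           (overlap {a i..<a i + 1} {a j..<a j + 1} \<longleftrightarrow> \<bar>int i - int j\<bar> = 1)))"

definition OPT :: "real set set \<Rightarrow> nat" where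
  "OPT I = Max (card ` {J. J \<subseteq> I \<and> pairwise (\<lambda>A B. \<not> overlap A B) J})"

text \<open>The first argument is the set of intervals accepted so far, the second the arrivals to come.\<close>

fun greedy :: "real set set \<Rightarrow> real set list \<Rightarrow> real set set" where
  "greedy S [] = S"
| "greedy S (A # \<sigma>) = greedy (if \<exists>B\<in>S. overlap A B then S else insert A S) \<sigma>"

definition ALG :: "real set list \<Rightarrow> nat" where
  "ALG \<sigma> = card (greedy {} \<sigma>)"

definition expected_ALG :: "real set set \<Rightarrow> real" where
  "expected_ALG I =
     measure_pmf.expectation (pmf_of_set (permutations_of_set I)) (\<lambda>\<sigma>. real (ALG \<sigma>))"

definition greedy_competitive_on_chains :: "real \<Rightarrow> bool" where
  "greedy_competitive_on_chains \<rho> \<longleftrightarrow>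
     (\<exists>b :: real. \<forall>n I. n \<ge> 1 \<longrightarrow> simple_chain n I \<longrightarrow>
        expected_ALG I \<ge> \<rho> * real (OPT I) - b)"

end

theory Submission
  imports Defs
begin

text \<open>
  The first arriving interval splits the chain into the two subchains of intervals not meeting it,
  and the greedy runs on these are independent, each in uniformly random order. Hence the expected
  value \<open>E n\<close> satisfies \<open>n E n = n + 2 (E 0 + \<dots> + E (n - 2))\<close>. Differencing twice gives
  \<open>E n = (\<Sum>k<n. (n - k) t k)\<close> with \<open>t k = (- 2)^k / (k + 1)!\<close>. As \<open>t\<close> sums to \<open>(1 - exp (- 2)) / 2\<close>,
  the error \<open>n (1 - exp (- 2)) / 2 - E n\<close> is the series of \<open>min n k * t k\<close>, which is
  bounded by \<open>exp 2\<close>, whereas \<open>OPT\<close> differs from \<open>n / 2\<close> by at most \<open>1 / 2\<close>.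
\<close>

subsection \<open>The greedy algorithm\<close>

lemma finite_greedy: "finite S \<Longrightarrow> finite (greedy S \<sigma>)"
  by (induction S \<sigma> rule: greedy.induct) auto

lemma greedy_subset: "greedy S \<sigma> \<subseteq> S \<union> set \<sigma>"
  by (induction S \<sigma> rule: greedy.induct) (auto split: if_splits)

text \<open>Arrivals that overlap a member of \<open>S\<close> are rejected whatever happens
  elsewhere, and the others are decided by \<open>T\<close> alone. So \<open>S\<close> factors out
  of the run. Taking \<open>S\<close> to be the first accepted interval yields
  \<open>ALG_Cons\<close>.\<close>

lemma greedy_Un_blocked:
  "greedy (S \<union> T) \<sigma> = S \<union> greedy T (filter (\<lambda>A. \<not> (\<exists>B\<in>S. overlap A B)) \<sigma>)"
proof (induction \<sigma> arbitrary: T)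
  case (Cons A \<sigma>)
  show ?case
  proof (cases "\<exists>B\<in>S. overlap A B")
    case True
    then have "\<exists>B\<in>S \<union> T. overlap A B" by auto
    then have "greedy (S \<union> T) (A # \<sigma>) = greedy (S \<union> T) \<sigma>"
      by simp
    with True Cons show ?thesis by (auto simp del: greedy.simps)
  next
    case False
    let ?T = "if \<exists>B\<in>T. overlap A B then T else insert A T"
    have "greedy (S \<union> T) (A # \<sigma>) = greedy (S \<union> ?T) \<sigma>"
      using False by (simp add: bex_Un)
    also have "\<dots> = S \<union> greedy ?T (filter (\<lambda>A. \<not> (\<exists>B\<in>S. overlap A B)) \<sigma>)"
      by (rule Cons.IH)
    finally show ?thesis using False by simp
  qed
qed simp

text \<open>Each decision depends only on accepted intervals from the arrival's own class, so the
  run is two interleaved runs that ignore each other. Both orders of \<open>overlap\<close> are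
  assumed because the arrival, always the first argument, may lie in either class. The accumulators
  \<open>S\<close> and \<open>T\<close> are general for the sake of the induction.\<close>

lemma greedy_separated:
  assumes "\<And>A B. A \<in> S \<union> T \<union> set \<sigma> \<Longrightarrow> B \<in> S \<union> T \<union> set \<sigma> \<Longrightarrow> P A \<Longrightarrow> \<not> P B \<Longrightarrow>
             \<not> overlap A B \<and> \<not> overlap B A"
    and "\<And>A. A \<in> S \<Longrightarrow> P A" and "\<And>A. A \<in> T \<Longrightarrow> \<not> P A"
  shows "greedy (S \<union> T) \<sigma> = greedy S (filter P \<sigma>) \<union> greedy T (filter (\<lambda>A. \<not> P A) \<sigma>)"
  using assms
proof (induction \<sigma> arbitrary: S T)
  case (Cons A \<sigma>)
  show ?case
  proof (cases "P A")
    case True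
    have *: "(\<exists>B\<in>S \<union> T. overlap A B) \<longleftrightarrow> (\<exists>B\<in>S. overlap A B)"
      using True Cons.prems by auto
    let ?S = "if \<exists>B\<in>S. overlap A B then S else insert A S"
    have "greedy (S \<union> T) (A # \<sigma>) = greedy (?S \<union> T) \<sigma>"
      using * by simp
    also have "\<dots> = greedy ?S (filter P \<sigma>) \<union> greedy T (filter (\<lambda>A. \<not> P A) \<sigma>)"
      by (rule Cons.IH) (use True Cons.prems in \<open>auto split: if_splits\<close>)
    finally show ?thesis using True by simp
  next
    case False
    have *: "(\<exists>B\<in>S \<union> T. overlap A B) \<longleftrightarrow> (\<exists>B\<in>T. overlap A B)"
      using False Cons.prems by auto
    let ?T = "if \<exists>B\<in>T. overlap A B then T else insert A T"
    have "greedy (S \<union> T) (A # \<sigma>) = greedy (S \<union> ?T) \<sigma>"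
      using * by simp
    also have "\<dots> = greedy S (filter P \<sigma>) \<union> greedy ?T (filter (\<lambda>A. \<not> P A) \<sigma>)"
      by (rule Cons.IH) (use False Cons.prems in \<open>auto split: if_splits\<close>)
    finally show ?thesis using False by simp
  qed
qed simp

lemma ALG_Cons:
  assumes "A \<noteq> {}"
  shows "ALG (A # \<sigma>) = Suc (ALG (filter (\<lambda>B. \<not> overlap B A) \<sigma>))"
proof -
  have "greedy {} (A # \<sigma>) = insert A (greedy {} (filter (\<lambda>B. \<not> overlap B A) \<sigma>))"
    using greedy_Un_blocked[of "{A}" "{}" \<sigma>] by simp
  \<comment> \<open>A nonempty interval overlaps itself, so the filter removes any later copy of
    \<open>A\<close> and \<open>A\<close> is counted once.\<close>
  moreover have "A \<notin> greedy {} (filter (\<lambda>B. \<not> overlap B A) \<sigma>)"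
    using greedy_subset[of "{}" "filter (\<lambda>B. \<not> overlap B A) \<sigma>"] assms
    by (auto simp: overlap_def)
  ultimately show ?thesis by (simp add: ALG_def finite_greedy)
qed

lemma ALG_separated:
  assumes "\<And>A B. A \<in> set \<sigma> \<Longrightarrow> B \<in> set \<sigma> \<Longrightarrow> P A \<Longrightarrow> \<not> P B \<Longrightarrow> \<not> overlap A B"
  shows "ALG \<sigma> = ALG (filter P \<sigma>) + ALG (filter (\<lambda>A. \<not> P A) \<sigma>)"
proof -
  have "greedy ({} \<union> {}) \<sigma> = greedy {} (filter P \<sigma>) \<union> greedy {} (filter (\<lambda>A. \<not> P A) \<sigma>)"
    by (rule greedy_separated) (use assms in \<open>auto simp: overlap_def Int_commute\<close>)
  moreover have "greedy {} (filter P \<sigma>) \<inter> greedy {} (filter (\<lambda>A. \<not> P A) \<sigma>) = {}"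
    using greedy_subset[of "{}" "filter P \<sigma>"]
      greedy_subset[of "{}" "filter (\<lambda>A. \<not> P A) \<sigma>"] by auto
  ultimately show ?thesis
    by (simp add: ALG_def card_Un_disjoint finite_greedy)
qed

subsection \<open>Expected value over a random order\<close>

abbreviation random_order :: "'a set \<Rightarrow> 'a list pmf" where
  "random_order A \<equiv> pmf_of_set (permutations_of_set A)"

text \<open>Partitioning a uniform order yields a pair of independent uniform orders of the two
  classes; this is its first marginal.\<close>

lemma filter_random_order:
  assumes "finite A"
  shows "map_pmf (filter P) (random_order A) = random_order {x \<in> A. P x}"
proof -
  have "map_pmf (filter P) (random_order A) = map_pmf fst (map_pmf (partition P) (random_order A))"
    by (simp add: map_pmf_comp o_def)
  then show ?thesis
    by (simp add: partition_random_permutations[OF assms] map_fst_pair_pmf)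
qed

lemma finite_set_pmf_random_order: "finite A \<Longrightarrow> finite (set_pmf (random_order A))"
  by (subst set_pmf_of_set) (auto simp: permutations_of_set_empty_iff)

lemma expected_ALG_filter:
  assumes "finite A"
  shows "measure_pmf.expectation (random_order A) (\<lambda>\<sigma>. real (ALG (filter P \<sigma>))) =
         expected_ALG {x \<in> A. P x}"
  unfolding expected_ALG_def filter_random_order[OF assms, symmetric] by simp

text \<open>By \<open>ALG_separated\<close> the value splits pointwise, and linearity of expectation
  leaves the two marginal orders, each uniform by \<open>filter_random_order\<close>.\<close>

lemma expected_ALG_separated:
  assumes "finite A" "finite B" "A \<inter> B = {}"
    and "\<And>X Y. X \<in> A \<Longrightarrow> Y \<in> B \<Longrightarrow> \<not> overlap X Y"
  shows "expected_ALG (A \<union> B) = expected_ALG A + expected_ALG B"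
proof -
  let ?M = "random_order (A \<union> B)"
  have fin: "finite (A \<union> B)" using assms by simp
  have eq: "{x \<in> A \<union> B. x \<in> A} = A" "{x \<in> A \<union> B. x \<notin> A} = B"
    using assms by auto
  have "expected_ALG (A \<union> B) = measure_pmf.expectation ?M
          (\<lambda>\<sigma>. real (ALG (filter (\<lambda>x. x \<in> A) \<sigma>)) + real (ALG (filter (\<lambda>x. x \<notin> A) \<sigma>)))"
    unfolding expected_ALG_def
  proof (rule integral_cong_AE)
    show "AE \<sigma> in ?M. real (ALG \<sigma>) =
        real (ALG (filter (\<lambda>x. x \<in> A) \<sigma>)) + real (ALG (filter (\<lambda>x. x \<notin> A) \<sigma>))"
    proof (rule AE_pmfI)
      fix \<sigma> assume "\<sigma> \<in> set_pmf ?M"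
      then have "set \<sigma> = A \<union> B"
        using fin by (auto simp: permutations_of_set_empty_iff permutations_of_setD)
      then show "real (ALG \<sigma>) =
          real (ALG (filter (\<lambda>x. x \<in> A) \<sigma>)) + real (ALG (filter (\<lambda>x. x \<notin> A) \<sigma>))"
        using assms(4) ALG_separated[of \<sigma> "\<lambda>x. x \<in> A"] by simp
    qed
  qed auto
  also have "\<dots> = expected_ALG A + expected_ALG B"
    by (subst Bochner_Integration.integral_add)
       (auto simp: expected_ALG_filter[OF fin] eq simp del: Un_iff
         intro!: integrable_measure_pmf_finite finite_set_pmf_random_order fin)
  finally show ?thesis .
qed

text \<open>Condition on the first arrival \<open>X\<close>, which is uniform in \<open>A\<close>:
  it is accepted, and the intervals not meeting it then arrive in uniformly random order.\<close>

lemma expected_ALG_first_arrival: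
  assumes "finite A" "A \<noteq> {}" "{} \<notin> A"
  shows "expected_ALG A = (\<Sum>X\<in>A. 1 + expected_ALG {Y \<in> A. \<not> overlap Y X}) / card A"
proof -
  have first: "measure_pmf.expectation (map_pmf ((#) X) (random_order (A - {X}))) (\<lambda>\<sigma>. real (ALG \<sigma>)) =
    1 + expected_ALG {Y \<in> A. \<not> overlap Y X}" if "X \<in> A" for X
  proof -
    have "X \<noteq> {}" using that assms by auto
    then have "measure_pmf.expectation (map_pmf ((#) X) (random_order (A - {X}))) (\<lambda>\<sigma>. real (ALG \<sigma>)) =
      measure_pmf.expectation (random_order (A - {X}))
        (\<lambda>\<sigma>. 1 + real (ALG (filter (\<lambda>B. \<not> overlap B X) \<sigma>)))"
      by (simp add: ALG_Cons)
    also have "\<dots> = 1 + expected_ALG {Y \<in> A - {X}. \<not> overlap Y X}"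
      using assms
      by (subst Bochner_Integration.integral_add)
         (auto simp: expected_ALG_filter
           intro!: integrable_measure_pmf_finite finite_set_pmf_random_order)
    also have "{Y \<in> A - {X}. \<not> overlap Y X} = {Y \<in> A. \<not> overlap Y X}"
      using \<open>X \<noteq> {}\<close> by (auto simp: overlap_def)
    finally show ?thesis .
  qed
  have "random_order A = pmf_of_set A \<bind> (\<lambda>X. map_pmf ((#) X) (random_order (A - {X})))"
    using random_permutation_of_set[OF assms(1,2)] by (simp add: map_pmf_def)
  then have "expected_ALG A = measure_pmf.expectation
      (pmf_of_set A \<bind> (\<lambda>X. map_pmf ((#) X) (random_order (A - {X})))) (\<lambda>\<sigma>. real (ALG \<sigma>))"
    by (simp add: expected_ALG_def)
  also have "\<dots> = (\<Sum>X\<in>A. measure_pmf.expectation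
      (map_pmf ((#) X) (random_order (A - {X}))) (\<lambda>\<sigma>. real (ALG \<sigma>)) / card A)"
    using assms
    by (subst pmf_expectation_bind_pmf_of_set)
       (auto simp: finite_set_pmf_random_order field_simps)
  also have "\<dots> = (\<Sum>X\<in>A. 1 + expected_ALG {Y \<in> A. \<not> overlap Y X}) / card A"
    by (simp only: first sum_divide_distrib cong: sum.cong)
  finally show ?thesis .
qed

subsection \<open>The value of greedy on chains\<close>

text \<open>These are the power series coefficients of
  \<open>(1 - exp (- 2 * x)) / (2 * x)\<close>.\<close>

definition chain_term :: "nat \<Rightarrow> real" where
  "chain_term k = (- 2) ^ k / fact (k + 1)"

text \<open>A twofold partial sum of \<open>chain_term\<close>, in closed form so that the limit of
  its first differences can be read off as a series.\<close>

definition chain_value :: "nat \<Rightarrow> real" where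
  "chain_value n = (\<Sum>k<n. real (n - k) * chain_term k)"

lemma chain_value_0 [simp]: "chain_value 0 = 0"
  by (simp add: chain_value_def)

lemma chain_value_Suc: "chain_value (Suc n) = chain_value n + (\<Sum>k\<le>n. chain_term k)"
proof -
  have "chain_value (Suc n) = (\<Sum>k<n. real (n - k) * chain_term k + chain_term k) + chain_term n"
    unfolding chain_value_def
    by (simp, intro sum.cong) (auto simp: Suc_diff_le algebra_simps)
  then show ?thesis
    by (simp add: chain_value_def sum.distrib lessThan_Suc_atMost[symmetric])
qed

lemma chain_term_Suc: "(real n + 2) * chain_term (Suc n) = - 2 * chain_term n"
proof -
  have "fact (Suc n + 1) = (real n + 2) * fact (n + 1)"
    by (simp add: algebra_simps)
  moreover have "real n + 2 \<noteq> 0" by linarith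
  ultimately show ?thesis by (simp add: chain_term_def del: fact_Suc)
qed

text \<open>This is the recurrence for the expected value after one differencing, written through
  the first differences of \<open>chain_value\<close>. Passing from \<open>n\<close> to
  \<open>n + 1\<close> differences it again, and what remains is exactly
  \<open>chain_term_Suc\<close>.\<close>

lemma chain_value_difference:
  "(real n + 2) * (\<Sum>k\<le>Suc n. chain_term k) + (\<Sum>k\<le>n. chain_term k) = 1 + chain_value n"
proof (induction n)
  case 0
  show ?case by (simp add: chain_term_def)
next
  case (Suc n)
  show ?case
    using Suc chain_term_Suc[of "Suc n"] by (simp add: chain_value_Suc algebra_simps)
qed

lemma chain_value_step:
  "(real n + 2) * chain_value (n + 2) = (real n + 1) * chain_value (n + 1) + 1 + 2 * chain_value n"
  using chain_value_difference[of n] by (simp add: chain_value_Suc algebra_simps)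

text \<open>Summing \<open>chain_value_step\<close> undoes the differencing. The result is the
  first-arrival recurrence for a chain of size \<open>n + 1\<close>, whose remaining segments have
  at most \<open>n - 1\<close> intervals.\<close>

lemma chain_value_recurrence:
  "(real n + 1) * chain_value (n + 1) = real n + 1 + 2 * (\<Sum>j<n. chain_value j)"
proof (induction n)
  case 0
  show ?case by (simp add: chain_value_def chain_term_def)
next
  case (Suc n)
  then show ?case using chain_value_step[of n] by (simp add: algebra_simps)
qed

lemma chain_value_bound: "\<bar>chain_value n - (1 - exp (- 2)) / 2 * real n\<bar> \<le> exp 2"
proof -
  define f where "f k = real (min n k) * chain_term k" for k
  have "(\<lambda>k. (- 2) ^ Suc k / fact (Suc k)) sums (exp (- 2) - 1 :: real)"
    using exp_converges[of "- 2 :: real"] by (subst sums_Suc_iff) (simp add: divide_inverse mult.commute)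
  from sums_mult[OF this, of "- 1 / 2"]
  have "chain_term sums (- 1 / 2 * (exp (- 2) - 1))"
    by (simp add: chain_term_def[abs_def] del: fact_Suc)
  also have "- 1 / 2 * (exp (- 2) - 1) = (1 - exp (- 2)) / (2 :: real)"
    by (simp add: field_simps)
  finally have term_sums: "chain_term sums ((1 - exp (- 2)) / 2)" .
  \<comment> \<open>Truncated subtraction makes all terms with \<open>k \<ge> n\<close> vanish. The
    difference \<open>real n - real (n - k)\<close> is then \<open>min n k\<close>, which gives
    \<open>f\<close>.\<close>
  have "(\<lambda>k. real (n - k) * chain_term k) sums chain_value n"
    unfolding chain_value_def by (rule sums_finite) auto
  from sums_diff[OF sums_mult[OF term_sums, of "real n"] this]
  have f_sums: "f sums (real n * ((1 - exp (- 2)) / 2) - chain_value n)"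
    by (rule sums_cong[THEN iffD1, rotated])
       (auto simp: f_def min_def of_nat_diff algebra_simps)
  have exp_sums: "(\<lambda>k. 2 ^ k / fact k) sums (exp 2 :: real)"
    using exp_converges[of "2 :: real"] by (simp add: divide_inverse mult.commute)
  have "norm (f k) \<le> 2 ^ k / fact k" for k
  proof -
    have "norm (f k) = real (min n k) * 2 ^ k / (real (k + 1) * fact k)"
      by (simp add: f_def chain_term_def abs_mult power_abs)
    \<comment> \<open>Bounding \<open>min n k\<close> by \<open>k + 1\<close> cancels the last
      factor of the factorial and leaves the series of \<open>exp 2\<close>, uniformly in
      \<open>n\<close>.\<close>
    also have "\<dots> \<le> real (k + 1) * 2 ^ k / (real (k + 1) * fact k)"
      by (intro divide_right_mono mult_right_mono) auto
    also have "\<dots> = 2 ^ k / fact k"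
      by (subst mult_divide_mult_cancel_left) auto
    finally show ?thesis .
  qed
  then have "norm (suminf f) \<le> (\<Sum>k. 2 ^ k / fact k)"
    using exp_sums by (intro norm_suminf_le) (auto simp: sums_iff)
  then show ?thesis
    using f_sums exp_sums by (simp add: sums_iff abs_minus_commute mult.commute)
qed

subsection \<open>Chains\<close>

text \<open>Shifting the index by \<open>l\<close> preserves order and index differences. This makes
  the induction hypothesis applicable to the pieces on either side of the first arrival.\<close>

lemma simple_chain_segment:
  fixes a :: "nat \<Rightarrow> real"
  assumes "strict_mono_on {1..n} a"
    and "\<And>i j. i \<in> {1..n} \<Longrightarrow> j \<in> {1..n} \<Longrightarrow> i \<noteq> j \<Longrightarrow>
      overlap {a i..<a i + 1} {a j..<a j + 1} \<longleftrightarrow> \<bar>int i - int j\<bar> = 1"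
    and "l + m \<le> n"
  shows "simple_chain m ((\<lambda>i. {a i..<a i + 1}) ` {l + 1..l + m})"
proof -
  let ?b = "\<lambda>i. a (i + l)"
  have "strict_mono_on {1..m} ?b"
    using assms(1,3) by (auto simp: strict_mono_on_def)
  moreover have "(\<lambda>i. {a i..<a i + 1}) ` {l + 1..l + m} = (\<lambda>i. {?b i..<?b i + 1}) ` {1..m}"
  proof -
    have "{l + 1..l + m} = (\<lambda>i. i + l) ` {1..m}" by (simp add: add.commute)
    then show ?thesis by (simp only: image_image)
  qed
  moreover have "\<forall>i\<in>{1..m}. \<forall>j\<in>{1..m}. i \<noteq> j \<longrightarrow>
      (overlap {?b i..<?b i + 1} {?b j..<?b j + 1} \<longleftrightarrow> \<bar>int i - int j\<bar> = 1)"
    using assms(2,3) by auto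
  ultimately show ?thesis unfolding simple_chain_def by blast
qed

lemma unit_interval_inj: "inj_on a S \<Longrightarrow> inj_on (\<lambda>i. {a i..<a i + 1 :: real}) S"
  by (auto simp: inj_on_def atLeastLessThan_eq_iff)

lemma expected_ALG_simple_chain: "simple_chain n I \<Longrightarrow> expected_ALG I = chain_value n"
proof (induction n arbitrary: I rule: less_induct)
  case (less n)
  from less.prems obtain a where mono: "strict_mono_on {1..n} a"
    and I: "I = (\<lambda>i. {a i..<a i + 1}) ` {1..n}"
    and ov: "\<And>i j. i \<in> {1..n} \<Longrightarrow> j \<in> {1..n} \<Longrightarrow> i \<noteq> j \<Longrightarrow>
      overlap {a i..<a i + 1} {a j..<a j + 1} \<longleftrightarrow> \<bar>int i - int j\<bar> = 1"
    unfolding simple_chain_def by blast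
  define c where "c i = {a i..<a i + 1}" for i
  have I: "I = c ` {1..n}" using I by (simp add: c_def)
  have inj: "inj_on c {1..n}"
    unfolding c_def by (intro unit_interval_inj strict_mono_on_imp_inj_on mono)
  have segment: "simple_chain k (c ` {l + 1..l + k})" if "l + k \<le> n" for l k
    unfolding c_def using simple_chain_segment[OF mono ov that] .
  \<comment> \<open>Including \<open>i = j\<close> lets one condition exclude the first arrival
    together with its neighbours.\<close>
  have c_ov: "overlap (c i) (c j) \<longleftrightarrow> \<bar>int i - int j\<bar> \<le> 1" if "i \<in> {1..n}" "j \<in> {1..n}" for i j
  proof (cases "i = j")
    case True
    then show ?thesis by (auto simp: c_def overlap_def)
  next
    case False
    with ov[OF that False] show ?thesis unfolding c_def by auto
  qed
  show ?case
  proof (cases n)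
    case 0
    then show ?thesis using I by (simp add: expected_ALG_def ALG_def pmf_of_set_singleton)
  next
    case (Suc m)
    have rest: "expected_ALG {Y \<in> I. \<not> overlap Y (c i)} = chain_value (i - 2) + chain_value (n - i - 1)"
      if i: "i \<in> {1..n}" for i
    proof -
      let ?L = "c ` {0 + 1..0 + (i - 2)}" and ?R = "c ` {(i + 1) + 1..(i + 1) + (n - i - 1)}"
      have L: "expected_ALG ?L = chain_value (i - 2)"
        by (rule less.IH) (use i in \<open>auto intro: segment[of 0, simplified]\<close>)
      have R: "expected_ALG ?R = chain_value (n - i - 1)"
      \<comment> \<open>For \<open>i = n\<close> the offset \<open>i + 1\<close> exceeds
        \<open>n\<close>, so \<open>segment\<close> does not apply; the right piece is then
        empty.\<close>
      proof (cases "i + 1 \<le> n")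
        case True
        then have "simple_chain (n - i - 1) ?R" by (intro segment) simp
        then show ?thesis using i by (intro less.IH) auto
      next
        case False
        then show ?thesis by (simp add: expected_ALG_def ALG_def pmf_of_set_singleton)
      qed
      have sub: "{0 + 1..0 + (i - 2)} \<subseteq> {1..n}" "{(i + 1) + 1..(i + 1) + (n - i - 1)} \<subseteq> {1..n}"
        using i by auto
      have "{Y \<in> I. \<not> overlap Y (c i)} = c ` {j \<in> {1..n}. \<not> \<bar>int j - int i\<bar> \<le> 1}"
        using i c_ov unfolding I by blast
      also have "{j \<in> {1..n}. \<not> \<bar>int j - int i\<bar> \<le> 1} =
          {0 + 1..0 + (i - 2)} \<union> {(i + 1) + 1..(i + 1) + (n - i - 1)}"
        using i by auto
      finally have split: "{Y \<in> I. \<not> overlap Y (c i)} = ?L \<union> ?R"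
        by (simp only: image_Un)
      have "expected_ALG (?L \<union> ?R) = expected_ALG ?L + expected_ALG ?R"
      proof (rule expected_ALG_separated)
        have "?L \<inter> ?R = c ` ({0 + 1..0 + (i - 2)} \<inter> {(i + 1) + 1..(i + 1) + (n - i - 1)})"
          by (rule inj_on_image_Int[OF inj sub, symmetric])
        then show "?L \<inter> ?R = {}" by auto
        fix X Y assume "X \<in> ?L" "Y \<in> ?R"
        then obtain j k where "X = c j" "Y = c k" "j \<in> {1..n}" "k \<in> {1..n}" "j + 2 \<le> i" "i + 2 \<le> k"
          using i by fastforce
        with c_ov show "\<not> overlap X Y" by auto
      qed auto
      then show ?thesis using L R split by simp
    qed
    have fin: "finite I" "I \<noteq> {}" "{} \<notin> I" "card I = n"
      using Suc inj unfolding I by (auto simp: card_image) (auto simp: c_def)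
    have "expected_ALG I = (\<Sum>X\<in>I. 1 + expected_ALG {Y \<in> I. \<not> overlap Y X}) / n"
      using expected_ALG_first_arrival[OF fin(1-3)] fin(4) by simp
    also have "(\<Sum>X\<in>I. 1 + expected_ALG {Y \<in> I. \<not> overlap Y X}) =
        (\<Sum>i\<in>{1..n}. 1 + (chain_value (i - 2) + chain_value (n - i - 1)))"
      by (rule sum.reindex_cong[OF inj I]) (simp add: rest)
    also have "\<dots> = n + (\<Sum>i\<in>{1..n}. chain_value (i - 2)) + (\<Sum>i\<in>{1..n}. chain_value (n - i - 1))"
      by (simp add: sum.distrib)
    \<comment> \<open>Reflecting the chain exchanges left and right pieces.\<close>
    also have "(\<Sum>i\<in>{1..n}. chain_value (n - i - 1)) = (\<Sum>i\<in>{1..n}. chain_value (i - 2))"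
      by (rule sum.reindex_bij_witness[of _ "\<lambda>i. n + 1 - i" "\<lambda>i. n + 1 - i"])
         (auto simp: algebra_simps)
    \<comment> \<open>Both \<open>i = 1\<close> and \<open>i = 2\<close> give index 0 by truncation;
      the extra term is harmless since \<open>chain_value 0 = 0\<close>.\<close>
    also have "(\<Sum>i\<in>{1..n}. chain_value (i - 2)) = (\<Sum>j<m. chain_value j)"
    proof -
      have "(\<Sum>i\<in>{1..Suc k}. chain_value (i - 2)) = (\<Sum>j<k. chain_value j)" for k
        by (induction k) (simp_all add: sum.atLeast_Suc_atMost)
      then show ?thesis using Suc by simp
    qed
    also have "(real n + (\<Sum>j<m. chain_value j) + (\<Sum>j<m. chain_value j)) / n = chain_value n"
      using chain_value_recurrence[of m] Suc by (simp add: field_simps)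
    finally show ?thesis .
  qed
qed

section \<open>The optimum on a chain, and chains of every size\<close>

text \<open>Group the indices into blocks of consecutive numbers \<open>2 * k - 1\<close> and
  \<open>2 * k\<close>; the map \<open>(i + 1) div 2\<close> names the block. A non-overlapping
  selection takes at most one index per block, and the odd indices attain this bound.\<close>

lemma OPT_simple_chain:
  assumes "simple_chain n I"
  shows "OPT I = (n + 1) div 2"
proof -
  from assms obtain a where mono: "strict_mono_on {1..n} a"
    and I: "I = (\<lambda>i. {a i..<a i + 1}) ` {1..n}"
    and ov: "\<And>i j. i \<in> {1..n} \<Longrightarrow> j \<in> {1..n} \<Longrightarrow> i \<noteq> j \<Longrightarrow>
      overlap {a i..<a i + 1} {a j..<a j + 1} \<longleftrightarrow> \<bar>int i - int j\<bar> = 1"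
    unfolding simple_chain_def by blast
  define c where "c i = {a i..<a i + 1}" for i
  have I: "I = c ` {1..n}" using I by (simp add: c_def)
  have inj: "inj_on c {1..n}"
    unfolding c_def by (intro unit_interval_inj strict_mono_on_imp_inj_on mono)
  note ov = ov[folded c_def]
  let ?F = "{J. J \<subseteq> I \<and> pairwise (\<lambda>A B. \<not> overlap A B) J}"
  have "finite ?F" using I by auto
  moreover have "k \<le> (n + 1) div 2" if "k \<in> card ` ?F" for k
  proof -
    from that obtain J where J: "J \<subseteq> I" "pairwise (\<lambda>A B. \<not> overlap A B) J" "k = card J" by auto
    from J(1) obtain S where S: "S \<subseteq> {1..n}" "J = c ` S"
      unfolding I by (meson subset_imageE)
    have injS: "inj_on c S" using inj S by (meson inj_on_subset)
    have nonadj: "j \<noteq> Suc i" if "i \<in> S" "j \<in> S" for i j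
    proof
      assume j: "j = Suc i"
      have ij: "i \<in> {1..n}" "j \<in> {1..n}" using that S by auto
      have "overlap (c i) (c j)" using ov[OF ij] j by simp
      moreover have "c i \<noteq> c j" using inj_on_eq_iff[OF inj ij] j by simp
      moreover have "c i \<in> J" "c j \<in> J" using S that by simp_all
      ultimately show False using J(2) unfolding pairwise_def by blast
    qed
    have "inj_on (\<lambda>i. (i + 1) div 2) S"
    proof (rule inj_onI)
      fix i j assume "i \<in> S" "j \<in> S" "(i + 1) div 2 = (j + 1) div 2"
      then show "i = j" using nonadj[of i j] nonadj[of j i] by presburger
    qed
    moreover have "(\<lambda>i. (i + 1) div 2) ` S \<subseteq> {1..(n + 1) div 2}"
      using S by fastforce
    ultimately have "card S \<le> card {1..(n + 1) div 2}"
      by (intro card_inj_on_le) auto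
    then show ?thesis using J S injS by (simp add: card_image)
  qed
  moreover have "(n + 1) div 2 \<in> card ` ?F"
  proof -
    let ?S = "(\<lambda>k. 2 * k + 1) ` {..<(n + 1) div 2}"
    have S: "?S \<subseteq> {1..n}" by auto
    have "card (c ` ?S) = (n + 1) div 2"
      using inj_on_subset[OF inj S] by (simp add: card_image inj_on_def)
    moreover have "pairwise (\<lambda>A B. \<not> overlap A B) (c ` ?S)"
    proof (rule pairwiseI)
      fix A B assume "A \<in> c ` ?S" "B \<in> c ` ?S" "A \<noteq> B"
      then obtain k l where kl: "A = c (2 * k + 1)" "B = c (2 * l + 1)" "k \<noteq> l"
        "2 * k + 1 \<in> {1..n}" "2 * l + 1 \<in> {1..n}"
        using S by blast
      have "\<bar>int (2 * k + 1) - int (2 * l + 1)\<bar> \<noteq> 1" by presburger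
      with kl ov[of "2 * k + 1" "2 * l + 1"] show "\<not> overlap A B" by simp
    qed
    ultimately show ?thesis using S unfolding I by (intro image_eqI[of _ _ "c ` ?S"]) auto
  qed
  ultimately show ?thesis unfolding OPT_def by (intro Max_eqI) auto
qed

lemma simple_chain_exists: "\<exists>I. simple_chain n I"
proof -
  \<comment> \<open>Spacing 3/4 is below 1, so neighbours overlap, while twice the spacing exceeds
    1, so no other pair does.\<close>
  let ?a = "\<lambda>i :: nat. 3 / 4 * real i"
  have "overlap {?a i..<?a i + 1} {?a j..<?a j + 1} \<longleftrightarrow> \<bar>int i - int j\<bar> = 1" if "i \<noteq> j" for i j
  proof -
    have "overlap {?a i..<?a i + 1} {?a j..<?a j + 1} \<longleftrightarrow> max (?a i) (?a j) < min (?a i + 1) (?a j + 1)"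
      unfolding overlap_def Int_atLeastLessThan sup_max inf_min by simp
    also have "\<dots> \<longleftrightarrow> \<bar>int i - int j\<bar> = 1"
      using that by (auto simp: max_def min_def)
    finally show ?thesis .
  qed
  moreover have "strict_mono_on {1..n} ?a" by (auto simp: strict_mono_on_def)
  ultimately have "simple_chain n ((\<lambda>i. {?a i..<?a i + 1}) ` {1..n})"
    unfolding simple_chain_def by (intro exI[of _ ?a]) auto
  then show ?thesis ..
qed

section \<open>From the linear growth of the expected value to the exact ratio\<close>

theorem theorem1:
  "greedy_competitive_on_chains (1 - exp (- 2)) \<and>
   (\<forall>\<rho>. greedy_competitive_on_chains \<rho> \<longrightarrow> \<rho> \<le> 1 - exp (- 2))"
proof (intro conjI allI impI)
  let ?r = "1 - exp (- 2) :: real"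
  show "greedy_competitive_on_chains ?r"
    unfolding greedy_competitive_on_chains_def
  \<comment> \<open>In the additive constant, \<open>exp 2\<close> pays for the error in
    \<open>chain_value_bound\<close> and \<open>?r\<close> for the rounding in
    \<open>OPT I \<le> (n + 2) / 2\<close>.\<close>
  proof (intro exI[of _ "exp 2 + ?r"] allI impI)
    fix n :: nat and I assume I: "simple_chain n I"
    have "2 * OPT I \<le> n + 2"
      unfolding OPT_simple_chain[OF I] by linarith
    then have "real (2 * OPT I) \<le> real (n + 2)" by (rule of_nat_mono)
    then have "real (OPT I) \<le> (real n + 2) / 2" by simp
    then have "?r * real (OPT I) \<le> ?r * ((real n + 2) / 2)"
      by (intro mult_left_mono) auto
    also have "\<dots> = ?r / 2 * real n + ?r" by (simp add: field_simps)
    finally show "?r * real (OPT I) - (exp 2 + ?r) \<le> expected_ALG I"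
      using chain_value_bound[of n] unfolding expected_ALG_simple_chain[OF I] by linarith
  qed
next
  let ?r = "1 - exp (- 2) :: real"
  fix \<rho> assume "greedy_competitive_on_chains \<rho>"
  then obtain b where b: "\<And>n I. n \<ge> 1 \<Longrightarrow> simple_chain n I \<Longrightarrow>
      expected_ALG I \<ge> \<rho> * real (OPT I) - b"
    unfolding greedy_competitive_on_chains_def by blast
  show "\<rho> \<le> ?r"
  proof (rule ccontr)
    assume "\<not> \<rho> \<le> ?r"
    then have "\<rho> - ?r > 0" by simp
    \<comment> \<open>A ratio above \<open>?r\<close> would gain \<open>\<rho> - ?r\<close> per
      optimal interval, which eventually outgrows both additive constants.\<close>
    then obtain m where m: "exp 2 + b < real m * (\<rho> - ?r)"
      using reals_Archimedean3 by blast
    \<comment> \<open>An even size makes the optimum exactly \<open>n / 2 = Suc m\<close>, and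
      \<open>Suc\<close> ensures \<open>n \<ge> 1\<close>.\<close>
    define n where "n = 2 * Suc m"
    obtain I where I: "simple_chain n I" using simple_chain_exists by blast
    have "\<rho> * real (Suc m) - b \<le> chain_value n"
      using b[OF _ I] OPT_simple_chain[OF I] by (simp add: n_def expected_ALG_simple_chain[OF I])
    also have "\<dots> \<le> ?r / 2 * real n + exp 2"
      using chain_value_bound[of n] by linarith
    also have "\<dots> = ?r * real (Suc m) + exp 2" by (simp add: n_def)
    finally have "real (Suc m) * (\<rho> - ?r) \<le> exp 2 + b"
      by (simp add: algebra_simps)
    moreover have "real m * (\<rho> - ?r) \<le> real (Suc m) * (\<rho> - ?r)"
      using \<open>\<rho> - ?r > 0\<close> by (intro mult_right_mono) auto
    ultimately show False using m by linarith
  qed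
qed

end
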